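(* Let $d\geq 1$ be an integer and let $B_d(t)$ be $d$-dimensional Brownian motion, taking values in $\mathbb{R}^d$. Then almost surely $$\dim_{\mathrm{A}} B_d([0,1])=d ,$$ where $B_d([0,1])=\{B_d(t): t\in[0,1]\}\subset\mathbb{R}^d$.
   Context: $d$-dimensional Brownian motion is the vector-valued process $(W_1,\dots,W_d)$ with $W_1,\dots,W_d$ independent one-dimensional Wiener processes (with continuous paths). Assouad dimension: a non-empty compact set $F\subset\mathbb{R}^d$ is $s$-homogeneous if there is $C>0$ such that for all $R>0$, $r\in(0,R]$ and $x\in F$, $N(B(x,R)\cap F,r)\leq C(R/r)^s$, where $B(x,R)$ is the closed ball of centre $x$ and radius $R$ and $N(E,r)$ is the number of cubes of the grid of side length $r$ in $\mathbb{R}^d$ that intersect $E$. Then $\dim_{\mathrm{A}}F=\inf\{s\geq 0: F\text{ is } s\text{-homogeneous}\}$. *)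

theory Defs
  imports "HOL-Probability.Probability"
begin

locale wiener_process = prob_space M for M :: "'a measure" +
  fixes W :: "real \<Rightarrow> 'a \<Rightarrow> real"
  assumes measurable_W: "\<And>t. 0 \<le> t \<Longrightarrow> W t \<in> borel_measurable M"
    and start_0: "AE \<omega> in M. W 0 \<omega> = 0"
    and indep_increments: "\<And>(n::nat) (t :: nat \<Rightarrow> real).
          0 \<le> t 0 \<Longrightarrow> (\<And>i. i < n \<Longrightarrow> t i < t (Suc i)) \<Longrightarrow>
          indep_vars (\<lambda>_. borel) (\<lambda>i \<omega>. W (t (Suc i)) \<omega> - W (t i) \<omega>) {..<n}"
    and normal_increments: "\<And>s t. 0 \<le> s \<Longrightarrow> s < t \<Longrightarrow>
          distributed M lborel (\<lambda>\<omega>. W t \<omega> - W s \<omega>) (normal_density 0 (sqrt (t - s)))"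
    and continuous_paths: "AE \<omega> in M. continuous_on {0..} (\<lambda>t. W t \<omega>)"

text \<open>The components are independent as processes, i.e. as random elements of the
  product space of functions on \<^term>\<open>{0::real..}\<close>, not merely at each fixed time.\<close>

locale brownian_motion = prob_space M for M :: "'a measure" +
  fixes B :: "real \<Rightarrow> 'a \<Rightarrow> real ^ 'n"
  assumes wiener_components: "\<And>i. wiener_process M (\<lambda>t \<omega>. B t \<omega> $ i)"
    and indep_components:
      "indep_vars (\<lambda>_. PiM {0..} (\<lambda>_. borel)) (\<lambda>i \<omega>. \<lambda>t\<in>{0..}. B t \<omega> $ i) UNIV"

definition grid_cubes :: "real \<Rightarrow> (real ^ 'n) set set" where
  "grid_cubes r =
     range (\<lambda>k :: int ^ 'n. cbox (\<chi> i. r * of_int (k $ i)) (\<chi> i. r * (of_int (k $ i) + 1)))"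

text \<open>For bounded \<open>E\<close> and \<open>r > 0\<close> only finitely many cubes meet \<open>E\<close>, so \<^const>\<open>card\<close> is the
  true count; below it is only applied to subsets of balls.\<close>

definition grid_count :: "(real ^ 'n) set \<Rightarrow> real \<Rightarrow> nat" where
  "grid_count E r = card {Q \<in> grid_cubes r. Q \<inter> E \<noteq> {}}"

definition homogeneous :: "real \<Rightarrow> (real ^ 'n) set \<Rightarrow> bool" where
  "homogeneous s F \<longleftrightarrow>
     (\<exists>C>0. \<forall>R>0. \<forall>r\<in>{0<..R}. \<forall>x\<in>F. real (grid_count (cball x R \<inter> F) r) \<le> C * (R / r) powr s)"

text \<open>The infimum is over a set that is bounded below by 0 and contains \<^term>\<open>real CARD('n)\<close>,
  so the real-valued \<^const>\<open>Inf\<close> is the genuine infimum.\<close>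

definition assouad_dim :: "(real ^ 'n) set \<Rightarrow> real" where
  "assouad_dim F = Inf {s. 0 \<le> s \<and> homogeneous s F}"

end

theory Submission
  imports Defs "HOL-Real_Asymp.Real_Asymp"
begin

text \<open>
  Write \<open>d\<close> for the dimension. Counting grid cubes shows that every subset of Euclidean \<open>d\<close>-space is
  \<open>d\<close>-homogeneous. For the lower bound, fix \<open>N\<close>, put \<open>K = N ^ d\<close>, and split \<open>[0,1]\<close> into \<open>m\<close> blocks
  of \<open>K\<close> time steps of length \<open>\<delta> = 1 / (m * K)\<close> each. With a probability \<open>p > 0\<close> that by Brownian
  scaling does not depend on \<open>m\<close>, the \<open>K\<close> normalised increments of a block are so close to prescribed
  values that the path, observed at the grid times only, passes near all points of
  \<open>h * {0, 2, ..., 2 * (N - 1)} ^ d\<close>, where \<open>h = sqrt \<delta>\<close> and the origin is the position at the start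
  of the block. Then \<open>N ^ d\<close> distinct cubes of side \<open>h\<close> are met within a ball of radius \<open>3 * d * N * h\<close>.
  The blocks are independent, so no block succeeds with probability \<open>(1 - p) ^ m\<close>, which tends to
  \<open>0\<close> as \<open>m\<close> grows. Hence almost surely such balls exist for every \<open>N\<close>, and \<open>s\<close>-homogeneity forces
  \<open>N ^ d \<le> C * (3 * d * N) powr s\<close> for all \<open>N\<close>, that is \<open>d \<le> s\<close>.
\<close>

section \<open>Counting grid cubes in a ball: the upper bound\<close>

lemma finite_vec_box:
  fixes S :: "'n::finite \<Rightarrow> 'a set"
  assumes "\<And>c. finite (S c)"
  shows "finite {k :: 'a ^ 'n. \<forall>c. k $ c \<in> S c}"
    and "card {k :: 'a ^ 'n. \<forall>c. k $ c \<in> S c} = (\<Prod>c\<in>UNIV. card (S c))"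
proof -
  have eq: "{k :: 'a ^ 'n. \<forall>c. k $ c \<in> S c} = vec_lambda ` (PiE UNIV S)"
  proof (intro set_eqI iffI)
    fix k :: "'a ^ 'n" assume "k \<in> {k. \<forall>c. k $ c \<in> S c}"
    then have "vec_nth k \<in> PiE UNIV S" by auto
    then show "k \<in> vec_lambda ` (PiE UNIV S)" by (metis imageI vec_lambda_eta)
  qed (auto simp: PiE_iff)
  show "finite {k :: 'a ^ 'n. \<forall>c. k $ c \<in> S c}"
    unfolding eq by (intro finite_imageI finite_PiE) (auto simp: assms)
  have "inj_on (vec_lambda :: _ \<Rightarrow> 'a ^ 'n) (PiE UNIV S)"
    by (rule inj_onI) (metis UNIV_I vec_lambda_inverse)
  then show "card {k :: 'a ^ 'n. \<forall>c. k $ c \<in> S c} = (\<Prod>c\<in>UNIV. card (S c))"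
    unfolding eq by (simp add: card_image card_PiE)
qed

text \<open>A common point of cube and ball differs from \<open>x\<close> by at most
  \<open>R\<close> in each coordinate, which confines every index to an integer interval. The
  \<open>- 1\<close> admits cubes that start below the ball and only reach up into it.\<close>

lemma grid_cubes_meeting_cball:
  fixes x :: "real ^ 'n"
  assumes "0 < r"
  shows "{Q \<in> grid_cubes r. Q \<inter> cball x R \<noteq> {}} \<subseteq>
    (\<lambda>k :: int ^ 'n. cbox (\<chi> i. r * of_int (k $ i)) (\<chi> i. r * (of_int (k $ i) + 1))) `
      {k. \<forall>c. k $ c \<in> {\<lceil>(x $ c - R) / r\<rceil> - 1..\<lfloor>(x $ c + R) / r\<rfloor>}}"
proof
  fix Q assume "Q \<in> {Q \<in> grid_cubes r. Q \<inter> cball x R \<noteq> {}}"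
  then obtain k :: "int ^ 'n" and y
    where Q: "Q = cbox (\<chi> i. r * of_int (k $ i)) (\<chi> i. r * (of_int (k $ i) + 1))"
      and y: "y \<in> Q" "y \<in> cball x R"
    unfolding grid_cubes_def by blast
  have "\<lceil>(x $ c - R) / r\<rceil> - 1 \<le> k $ c \<and> k $ c \<le> \<lfloor>(x $ c + R) / r\<rfloor>" for c
  proof -
    have yc: "r * of_int (k $ c) \<le> y $ c" "y $ c \<le> r * (of_int (k $ c) + 1)"
      using y(1) unfolding Q by (simp_all add: mem_box_cart)
    have "\<bar>x $ c - y $ c\<bar> \<le> R"
      using y(2) component_le_norm_cart[of "x - y" c] by (simp add: dist_norm)
    with yc have *: "r * of_int (k $ c) \<le> x $ c + R" "x $ c - R \<le> r * (of_int (k $ c) + 1)"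
      by linarith+
    have "of_int (k $ c) \<le> (x $ c + R) / r" "(x $ c - R) / r \<le> of_int (k $ c + 1)"
      using * assms by (simp_all add: field_simps)
    then show ?thesis
      by (metis ceiling_le diff_le_eq le_floor_iff)
  qed
  then show "Q \<in> (\<lambda>k :: int ^ 'n. cbox (\<chi> i. r * of_int (k $ i)) (\<chi> i. r * (of_int (k $ i) + 1))) `
      {k. \<forall>c. k $ c \<in> {\<lceil>(x $ c - R) / r\<rceil> - 1..\<lfloor>(x $ c + R) / r\<rfloor>}}"
    unfolding Q by auto
qed

lemma finite_grid_cubes_meeting_cball:
  fixes x :: "real ^ 'n"
  assumes "0 < r"
  shows "finite {Q \<in> grid_cubes r. Q \<inter> cball x R \<noteq> {}}"
  by (rule finite_subset[OF grid_cubes_meeting_cball[OF assms]])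
    (intro finite_imageI finite_vec_box finite_atLeastAtMost_int)

text \<open>\<open>card\<close> is monotone only below a finite family; the enclosing ball supplies
  the finiteness.\<close>

lemma grid_count_mono_cball:
  fixes x :: "real ^ 'n"
  assumes "0 < r" "E \<subseteq> cball x R"
  shows "grid_count E r \<le> grid_count (cball x R) r"
  unfolding grid_count_def
  using finite_grid_cubes_meeting_cball[OF assms(1)] assms(2) by (intro card_mono) auto

text \<open>Each index interval contains at most \<open>2 * (R / r) + 2\<close> integers, and
  \<open>r \<le> R\<close> absorbs the 2 into another \<open>2 * (R / r)\<close>.\<close>

lemma grid_count_cball_le:
  fixes x :: "real ^ 'n"
  assumes "0 < r" "r \<le> R"
  shows "real (grid_count (cball x R) r) \<le> (4 * (R / r)) ^ CARD('n)"
proof -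
  define S where "S c = {\<lceil>(x $ c - R) / r\<rceil> - 1..\<lfloor>(x $ c + R) / r\<rfloor>}" for c
  have fin: "finite (S c)" for c by (simp add: S_def)
  have "grid_count (cball x R) r \<le> card {k :: int ^ 'n. \<forall>c. k $ c \<in> S c}"
    unfolding grid_count_def S_def
    by (rule surj_card_le[OF finite_vec_box(1) grid_cubes_meeting_cball[OF assms(1)]]) simp
  then have "real (grid_count (cball x R) r) \<le> (\<Prod>c\<in>UNIV. real (card (S c)))"
    unfolding finite_vec_box(2)[OF fin] by (metis of_nat_le_iff of_nat_prod)
  also have "\<dots> \<le> (\<Prod>c\<in>(UNIV :: 'n set). 4 * (R / r))"
  proof (rule prod_mono, safe)
    fix c
    have "1 \<le> R / r" using assms by simp
    moreover have "(x $ c + R) / r - (x $ c - R) / r = 2 * (R / r)"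
      by (simp add: diff_divide_distrib add_divide_distrib)
    moreover have "real_of_int (\<lfloor>(x $ c + R) / r\<rfloor> - (\<lceil>(x $ c - R) / r\<rceil> - 1) + 1)
        \<le> (x $ c + R) / r - (x $ c - R) / r + 2"
      using of_int_floor_le[of "(x $ c + R) / r"] le_of_int_ceiling[of "(x $ c - R) / r"]
      by simp linarith
    ultimately show "real (card (S c)) \<le> 4 * (R / r)"
      unfolding S_def by simp
  qed simp
  finally show ?thesis by simp
qed

text \<open>This is the deterministic half: it puts \<open>real CARD('n)\<close> among the
  admissible exponents of every path.\<close>

lemma homogeneous_CARD:
  fixes F :: "(real ^ 'n) set"
  shows "homogeneous (real CARD('n)) F"
  unfolding homogeneous_def
proof (intro exI[of _ "4 ^ CARD('n)"] conjI allI impI ballI)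
  fix R r :: real and x :: "real ^ 'n"
  assume "0 < R" "r \<in> {0<..R}" "x \<in> F"
  then have r: "0 < r" "r \<le> R" by auto
  have "real (grid_count (cball x R \<inter> F) r) \<le> real (grid_count (cball x R) r)"
    using grid_count_mono_cball[OF r(1), of "cball x R \<inter> F"] by simp
  also have "\<dots> \<le> (4 * (R / r)) ^ CARD('n)"
    by (rule grid_count_cball_le[OF r])
  also have "\<dots> = 4 ^ CARD('n) * (R / r) powr real CARD('n)"
    using r by (simp add: powr_realpow flip: power_mult_distrib)
  finally show "real (grid_count (cball x R \<inter> F) r) \<le> 4 ^ CARD('n) * (R / r) powr real CARD('n)" .
qed simp

section \<open>Separated points force a large exponent\<close>

text \<open>Rounding coordinates down assigns to each point a cube containing it. Points of one
  closed cube differ by at most \<open>r\<close> in every coordinate, so the strict gap makes the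
  assignment injective.\<close>

lemma card_le_grid_count:
  fixes p :: "'i \<Rightarrow> real ^ 'n"
  assumes "0 < r" "E \<subseteq> cball x R" "p ` I \<subseteq> E"
    and sep: "\<And>i j. i \<in> I \<Longrightarrow> j \<in> I \<Longrightarrow> i \<noteq> j \<Longrightarrow> \<exists>c. r < \<bar>p i $ c - p j $ c\<bar>"
  shows "card I \<le> grid_count E r"
proof -
  define k :: "'i \<Rightarrow> int ^ 'n" where "k i = (\<chi> c. \<lfloor>p i $ c / r\<rfloor>)" for i
  define Q where "Q i = cbox (\<chi> c. r * of_int (k i $ c)) (\<chi> c. r * (of_int (k i $ c) + 1))" for i
  have mem: "p i \<in> Q i" for i
  proof -
    have "r * of_int \<lfloor>p i $ c / r\<rfloor> \<le> p i $ c \<and> p i $ c \<le> r * (of_int \<lfloor>p i $ c / r\<rfloor> + 1)" for c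
      using floor_divide_lower[OF assms(1), of "p i $ c"] floor_divide_upper[OF assms(1), of "p i $ c"]
      by (simp add: mult.commute)
    then show ?thesis unfolding Q_def k_def by (simp add: mem_box_cart)
  qed
  have "inj_on Q I"
  proof (rule inj_onI, rule ccontr)
    fix i j assume ij: "i \<in> I" "j \<in> I" "Q i = Q j" "i \<noteq> j"
    then obtain c where c: "r < \<bar>p i $ c - p j $ c\<bar>" using sep by blast
    have "p i \<in> Q i" "p j \<in> Q i" using mem[of i] mem[of j] ij by auto
    then have "r * of_int (k i $ c) \<le> p i $ c" "p i $ c \<le> r * (of_int (k i $ c) + 1)"
       "r * of_int (k i $ c) \<le> p j $ c" "p j $ c \<le> r * (of_int (k i $ c) + 1)"
      unfolding Q_def by (simp_all add: mem_box_cart)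
    with c show False by (simp add: algebra_simps)
  qed
  moreover have "Q ` I \<subseteq> {Q \<in> grid_cubes r. Q \<inter> E \<noteq> {}}"
    using mem assms(3) unfolding grid_cubes_def Q_def by blast
  moreover have "finite {Q \<in> grid_cubes r. Q \<inter> E \<noteq> {}}"
    by (rule finite_subset[OF _ finite_grid_cubes_meeting_cball[OF assms(1), of x R]])
      (use assms(2) in auto)
  ultimately show ?thesis
    unfolding grid_count_def by (rule card_inj_on_le)
qed

text \<open>For \<open>R = A * N * h\<close> and \<open>r = h\<close> the ratio \<open>R / r\<close>
  no longer involves the unknown scale \<open>h\<close>. Homogeneity then bounds
  \<open>N powr (d - s)\<close>, with \<open>d\<close> the dimension, uniformly in \<open>N\<close>,
  which is impossible if \<open>s < d\<close>.\<close>

lemma CARD_le_homogeneous_exponent: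
  fixes F :: "(real ^ 'n) set"
  assumes hom: "homogeneous s F" and A: "1 \<le> A"
    and rich: "\<And>N::nat. 1 \<le> N \<Longrightarrow> \<exists>x\<in>F. \<exists>h>0. N ^ CARD('n) \<le> grid_count (cball x (A * real N * h) \<inter> F) h"
  shows "real CARD('n) \<le> s"
proof (rule ccontr)
  assume "\<not> real CARD('n) \<le> s"
  then have s: "real CARD('n) - s > 0" by simp
  from hom obtain C where C: "C > 0"
    "\<And>R r x. R > 0 \<Longrightarrow> r \<in> {0<..R} \<Longrightarrow> x \<in> F \<Longrightarrow>
       real (grid_count (cball x R \<inter> F) r) \<le> C * (R / r) powr s"
    unfolding homogeneous_def by blast
  have bound: "real N powr (real CARD('n) - s) \<le> C * A powr s" if N: "1 \<le> N" for N :: nat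
  proof -
    obtain x h where xh: "x \<in> F" "h > 0"
      "N ^ CARD('n) \<le> grid_count (cball x (A * real N * h) \<inter> F) h"
      using rich[OF N] by blast
    have AN: "1 \<le> A * real N" using A N by (metis mult_mono' mult_1 of_nat_1 of_nat_mono zero_le_one)
    have "real N powr real CARD('n) = real (N ^ CARD('n))" using N by (simp add: powr_realpow)
    also have "\<dots> \<le> C * (A * real N * h / h) powr s"
      using xh AN by (intro order_trans[OF _ C(2)]) (auto simp: of_nat_le_iff)
    also have "\<dots> = C * A powr s * real N powr s"
      using xh A N by (simp add: powr_mult)
    finally show ?thesis
      using N by (simp add: powr_diff field_simps)
  qed
  have "filterlim (\<lambda>N. real N powr (real CARD('n) - s)) at_top sequentially"
    using s by real_asymp
  then have "eventually (\<lambda>N. C * A powr s + 1 \<le> real N powr (real CARD('n) - s)) sequentially"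
    by (simp add: filterlim_at_top)
  with eventually_ge_at_top[of 1] have "eventually (\<lambda>N::nat. False) sequentially"
    by eventually_elim (use bound in fastforce)
  then show False by simp
qed

section \<open>Two probabilistic preliminaries\<close>

text \<open>Independence passes to the generated sigma-algebras, which contain the
  complements.\<close>

lemma (in prob_space) prob_none_of_indep_events:
  fixes m :: nat
  assumes ind: "indep_events E {..<m}" and p: "\<And>j. j < m \<Longrightarrow> prob (E j) = p"
  shows "prob (space M - (\<Union>j<m. E j)) = (1 - p) ^ m"
proof (cases "m = 0")
  \<comment> \<open>An intersection over no indices would be \<open>UNIV\<close> instead of
    \<open>space M\<close>, hence the separate case.\<close>
  case True then show ?thesis by (simp add: prob_space)
next
  case False
  have ev: "E j \<in> events" if "j < m" for j
    using ind that unfolding indep_events_def by auto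
  have "indep_sets (\<lambda>j. sigma_sets (space M) {E j}) {..<m}"
    using ind unfolding indep_events_def_alt by (rule indep_sets_sigma) (auto simp: Int_stable_def)
  then have "prob (\<Inter>j<m. space M - E j) = (\<Prod>j<m. prob (space M - E j))"
    by (rule indep_setsD) (use False in \<open>auto intro: sigma_sets.intros\<close>)
  also have "\<dots> = (1 - p) ^ m"
    using ev p by (simp add: prob_compl)
  also have "(\<Inter>j<m. space M - E j) = space M - (\<Union>j<m. E j)"
    using False by auto
  finally show ?thesis .
qed

text \<open>The Gaussian density vanishes nowhere, so an interval that is null for it would be null
  for Lebesgue measure.\<close>

lemma std_normal_interval_pos:
  assumes "a < b"
  shows "0 < measure (density lborel std_normal_density) {a<..<b}"
proof -
  interpret N: prob_space "density lborel std_normal_density"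
    by (rule prob_space_normal_density) simp
  have std_density_nz: "ennreal (std_normal_density x) \<noteq> 0" for x
    using normal_density_pos[of 1 0 x] by (simp add: ennreal_eq_0_iff not_le)
  have "emeasure (density lborel std_normal_density) {a<..<b} \<noteq> 0"
  proof
    assume "emeasure (density lborel std_normal_density) {a<..<b} = 0"
    then have "AE x in lborel. x \<notin> {a<..<b}"
      by (auto simp: emeasure_density nn_integral_0_iff_AE std_density_nz indicator_def
          split: if_splits elim!: eventually_mono)
    then have "emeasure lborel {a<..<b} = 0"
      by (subst (asm) AE_iff_measurable[OF _ refl]) (auto simp: greaterThanLessThan_def greaterThan_def lessThan_def Int_def)
    then show False using assms by simp
  qed
  then show ?thesis by (simp add: N.emeasure_eq_measure zero_less_measure_iff)
qed

section \<open>Normalised Brownian increments and independent blocks\<close>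

text \<open>Division by \<open>sqrt \<delta>\<close> is Brownian scaling: the law becomes standard
  normal for every step size \<open>\<delta> > 0\<close>.\<close>

definition std_increment :: "(real \<Rightarrow> 'a \<Rightarrow> real ^ 'n) \<Rightarrow> real \<Rightarrow> 'n \<Rightarrow> nat \<Rightarrow> 'a \<Rightarrow> real" where
  "std_increment B \<delta> c l \<omega> = (B (real (Suc l) * \<delta>) \<omega> $ c - B (real l * \<delta>) \<omega> $ c) / sqrt \<delta>"

context brownian_motion
begin

lemma distributed_std_increment:
  assumes "0 < \<delta>"
  shows "distributed M lborel (std_increment B \<delta> c l) std_normal_density"
proof -
  interpret W: wiener_process M "\<lambda>t \<omega>. B t \<omega> $ c" by (rule wiener_components)
  have "distributed M lborel (\<lambda>\<omega>. B (real (Suc l) * \<delta>) \<omega> $ c - B (real l * \<delta>) \<omega> $ c)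
      (normal_density 0 (sqrt (real (Suc l) * \<delta> - real l * \<delta>)))"
    using assms by (intro W.normal_increments) auto
  moreover have "real (Suc l) * \<delta> - real l * \<delta> = \<delta>" by (simp add: algebra_simps)
  ultimately show ?thesis
    using normal_standard_normal_convert[of "sqrt \<delta>" _ 0] assms
    by (simp add: std_increment_def[abs_def])
qed

lemma measurable_std_increment [measurable]:
  assumes "0 < \<delta>"
  shows "std_increment B \<delta> c l \<in> borel_measurable M"
  using distributed_measurable[OF distributed_std_increment[OF assms]] by simp

lemma prob_std_increment:
  assumes "0 < \<delta>" "S \<in> sets borel"
  shows "prob {\<omega> \<in> space M. std_increment B \<delta> c l \<omega> \<in> S} = measure (density lborel std_normal_density) S"
proof -
  have "measure (density lborel std_normal_density) S
      = measure (distr M lborel (std_increment B \<delta> c l)) S"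
    using distributed_distr_eq_density[OF distributed_std_increment[OF assms(1)]] by simp
  also have "\<dots> = prob (std_increment B \<delta> c l -` S \<inter> space M)"
    using assms by (intro measure_distr) auto
  also have "std_increment B \<delta> c l -` S \<inter> space M = {\<omega> \<in> space M. std_increment B \<delta> c l \<omega> \<in> S}"
    by auto
  finally show ?thesis by simp
qed

lemma prob_std_increments_component:
  fixes n :: nat
  assumes \<delta>: "0 < \<delta>" and "0 < n" and S: "\<And>l. l < n \<Longrightarrow> S l \<in> sets borel"
  shows "prob {\<omega> \<in> space M. \<forall>l<n. std_increment B \<delta> c l \<omega> \<in> S l}
    = (\<Prod>l<n. measure (density lborel std_normal_density) (S l))"
proof -
  interpret W: wiener_process M "\<lambda>t \<omega>. B t \<omega> $ c" by (rule wiener_components)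
  have "indep_vars (\<lambda>_. borel)
      (\<lambda>l \<omega>. B (real (Suc l) * \<delta>) \<omega> $ c - B (real l * \<delta>) \<omega> $ c) {..<n}"
    using W.indep_increments[of "\<lambda>l. real l * \<delta>" n] \<delta> by simp
  then have "indep_vars (\<lambda>_. borel) (\<lambda>l \<omega>. (\<lambda>x. x / sqrt \<delta>)
      (B (real (Suc l) * \<delta>) \<omega> $ c - B (real l * \<delta>) \<omega> $ c)) {..<n}"
    by (rule indep_vars_compose2) simp
  then have ind: "indep_vars (\<lambda>_. borel) (std_increment B \<delta> c) {..<n}"
    by (simp add: std_increment_def[abs_def])
  have "{\<omega> \<in> space M. \<forall>l<n. std_increment B \<delta> c l \<omega> \<in> S l}
      = (\<Inter>l<n. std_increment B \<delta> c l -` S l \<inter> space M)"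
    using \<open>0 < n\<close> by auto
  also have "prob \<dots> = (\<Prod>l<n. prob (std_increment B \<delta> c l -` S l \<inter> space M))"
    using \<open>0 < n\<close> S by (intro indep_varsD_finite[OF ind]) auto
  also have "\<dots> = (\<Prod>l<n. measure (density lborel std_normal_density) (S l))"
    using prob_std_increment[OF \<delta> S] by (intro prod.cong refl) (auto simp: vimage_def Int_def conj_commute)
  finally show ?thesis .
qed

text \<open>The constraints on component \<open>c\<close> form the preimage of a measurable set
  \<open>U c\<close> of paths. Independence of the components as processes therefore factorises over
  \<open>c\<close>, and independence of increments factorises over time.\<close>

lemma prob_std_increments:
  fixes n :: nat
  assumes \<delta>: "0 < \<delta>" and n: "0 < n" and S: "\<And>c l. l < n \<Longrightarrow> S c l \<in> sets borel"
  shows "prob {\<omega> \<in> space M. \<forall>c. \<forall>l<n. std_increment B \<delta> c l \<omega> \<in> S c l}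
    = (\<Prod>c\<in>UNIV. \<Prod>l<n. measure (density lborel std_normal_density) (S c l))"
proof -
  let ?P = "PiM {0..} (\<lambda>_. borel) :: (real \<Rightarrow> real) measure"
  define Y where "Y c \<omega> = (\<lambda>t\<in>{0..}. B t \<omega> $ c)" for c \<omega>
  define U where "U c = {y \<in> space ?P. \<forall>l<n.
      (y (real (Suc l) * \<delta>) - y (real l * \<delta>)) / sqrt \<delta> \<in> S c l}" for c
  have U: "U c \<in> sets ?P" for c
  proof -
    have [measurable]: "(\<lambda>y. y (real l * \<delta>)) \<in> borel_measurable ?P" for l
      using \<delta> by (intro measurable_component_singleton) simp
    have "{y \<in> space ?P. (y (real (Suc l) * \<delta>) - y (real l * \<delta>)) / sqrt \<delta> \<in> S c l} \<in> sets ?P"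
      if "l < n" for l
      using S[OF that] by measurable
    then have "{y \<in> space ?P. \<forall>l\<in>{..<n}. (y (real (Suc l) * \<delta>) - y (real l * \<delta>)) / sqrt \<delta> \<in> S c l} \<in> sets ?P"
      by (intro sets.sets_Collect_finite_All) auto
    then show ?thesis by (simp only: U_def Ball_def lessThan_iff)
  qed
  have eq: "Y c -` U c \<inter> space M = {\<omega> \<in> space M. \<forall>l<n. std_increment B \<delta> c l \<omega> \<in> S c l}" for c
    using \<delta> by (auto simp: Y_def U_def std_increment_def space_PiM)
  have "{\<omega> \<in> space M. \<forall>c. \<forall>l<n. std_increment B \<delta> c l \<omega> \<in> S c l} = (\<Inter>c\<in>UNIV. Y c -` U c \<inter> space M)"
    unfolding eq by auto
  also have "prob \<dots> = (\<Prod>c\<in>UNIV. prob (Y c -` U c \<inter> space M))"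
    using indep_components U unfolding Y_def by (intro indep_varsD_finite) auto
  also have "\<dots> = (\<Prod>c\<in>UNIV. \<Prod>l<n. measure (density lborel std_normal_density) (S c l))"
    unfolding eq using prob_std_increments_component[OF \<delta> n S] by (intro prod.cong refl) auto
  finally show ?thesis .
qed

text \<open>Distinct blocks use disjoint sets of increments, so the events \<open>E j\<close> are
  independent with a common probability.\<close>

lemma prob_no_block:
  fixes m K :: nat and I :: "'n \<Rightarrow> nat \<Rightarrow> real set"
  assumes \<delta>: "0 < \<delta>" and K: "0 < K" and I: "\<And>c i. I c i \<in> sets borel"
  defines "E \<equiv> \<lambda>j. {\<omega> \<in> space M. \<forall>c. \<forall>i<K. std_increment B \<delta> c (j * K + i) \<omega> \<in> I c i}"
  shows "prob (space M - (\<Union>j<m. E j))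
     = (1 - (\<Prod>c\<in>UNIV. \<Prod>i<K. measure (density lborel std_normal_density) (I c i))) ^ m"
    and "E j \<in> events"
proof -
  interpret N: prob_space "density lborel std_normal_density"
    by (rule prob_space_normal_density) simp
  let ?q = "\<lambda>S. measure (density lborel std_normal_density) S"
  have q_UNIV: "?q UNIV = 1" using N.prob_space by simp
  define p where "p = (\<Prod>c\<in>UNIV. \<Prod>i<K. ?q (I c i))"
  show ev: "E j \<in> events" for j
  proof -
    have "{\<omega> \<in> space M. std_increment B \<delta> c l \<omega> \<in> I c i} \<in> events" for c l i
      using I \<delta> by measurable
    then have "{\<omega> \<in> space M. \<forall>c\<in>UNIV. \<forall>i\<in>{..<K}. std_increment B \<delta> c (j * K + i) \<omega> \<in> I c i} \<in> events"
      by (intro sets.sets_Collect_finite_All) auto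
    then show ?thesis by (simp only: E_def Ball_def lessThan_iff UNIV_I simp_thms)
  qed
  \<comment> \<open>Singletons \<open>J\<close> give the common probability \<open>p\<close>;
    general \<open>J\<close> then give the product rule that defines independence.\<close>
  have INT: "prob (\<Inter>j\<in>J. E j) = p ^ card J" if J: "J \<subseteq> {..<m}" "J \<noteq> {}" for J
  proof -
    have m: "0 < m" using J by (cases m) auto
    \<comment> \<open>Indices outside the blocks in \<open>J\<close> get the trivial constraint \<open>UNIV\<close>, so that the product
      formula for all \<open>m * K\<close> increments applies.\<close>
    define S where "S c l = (if l div K \<in> J then I c (l mod K) else UNIV)" for c l
    have "(\<Inter>j\<in>J. E j) = {\<omega> \<in> space M. \<forall>c. \<forall>l<m * K. std_increment B \<delta> c l \<omega> \<in> S c l}"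
    proof (intro set_eqI iffI)
      fix \<omega> assume \<omega>: "\<omega> \<in> (\<Inter>j\<in>J. E j)"
      have "std_increment B \<delta> c l \<omega> \<in> S c l" for c l
      proof (cases "l div K \<in> J")
        case True
        then have "\<omega> \<in> E (l div K)" using \<omega> by auto
        then have "std_increment B \<delta> c (l div K * K + l mod K) \<omega> \<in> I c (l mod K)"
          unfolding E_def mem_Collect_eq using mod_less_divisor[OF K] by blast
        then show ?thesis using True by (simp add: S_def)
      qed (simp add: S_def)
      moreover have "\<omega> \<in> space M" using \<omega> J unfolding E_def by auto
      ultimately show "\<omega> \<in> {\<omega> \<in> space M. \<forall>c. \<forall>l<m * K. std_increment B \<delta> c l \<omega> \<in> S c l}" by simp
    next
      fix \<omega> assume \<omega>: "\<omega> \<in> {\<omega> \<in> space M. \<forall>c. \<forall>l<m * K. std_increment B \<delta> c l \<omega> \<in> S c l}"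
      show "\<omega> \<in> (\<Inter>j\<in>J. E j)"
      proof
        fix j assume j: "j \<in> J"
        have "std_increment B \<delta> c (j * K + i) \<omega> \<in> I c i" if i: "i < K" for c i
        proof -
          have "Suc j \<le> m" using j J by auto
          then have "Suc j * K \<le> m * K" by (rule mult_le_mono1)
          then have "j * K + i < m * K" using i by simp
          then have "std_increment B \<delta> c (j * K + i) \<omega> \<in> S c (j * K + i)" using \<omega> by auto
          then show ?thesis using i j by (simp add: S_def)
        qed
        then show "\<omega> \<in> E j" using \<omega> unfolding E_def by auto
      qed
    qed
    also have "prob \<dots> = (\<Prod>c\<in>UNIV. \<Prod>l<m * K. ?q (S c l))"
      using I m K by (intro prob_std_increments[OF \<delta>]) (auto simp: S_def)
    also have "\<dots> = (\<Prod>c\<in>UNIV. (\<Prod>i<K. ?q (I c i)) ^ card J)"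
    proof (rule prod.cong[OF refl])
      fix c
      have "(\<Prod>l<m * K. ?q (S c l)) = (\<Prod>j<m. \<Prod>l\<in>{j * K..<j * K + K}. ?q (S c l))"
        by (rule prod.nat_group[symmetric])
      also have "\<dots> = (\<Prod>j<m. if j \<in> J then \<Prod>i<K. ?q (I c i) else 1)"
      proof (rule prod.cong[OF refl])
        fix j
        have "(\<Prod>l\<in>{j * K..<j * K + K}. ?q (S c l)) = (\<Prod>i<K. ?q (S c (j * K + i)))"
          by (rule prod.reindex_bij_witness[of _ "\<lambda>i. j * K + i" "\<lambda>l. l - j * K"]) auto
        also have "\<dots> = (if j \<in> J then \<Prod>i<K. ?q (I c i) else 1)"
          by (auto simp: S_def q_UNIV)
        finally show "(\<Prod>l\<in>{j * K..<j * K + K}. ?q (S c l)) = (if j \<in> J then \<Prod>i<K. ?q (I c i) else 1)" .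
      qed
      also have "\<dots> = (\<Prod>i<K. ?q (I c i)) ^ card J"
        using J by (simp add: prod.If_cases Int_absorb1)
      finally show "(\<Prod>l<m * K. ?q (S c l)) = (\<Prod>i<K. ?q (I c i)) ^ card J" .
    qed
    also have "\<dots> = p ^ card J" by (simp add: p_def prod_power_distrib)
    finally show ?thesis .
  qed
  have pE: "prob (E j) = p" if "j < m" for j using INT[of "{j}"] that by simp
  have "indep_events E {..<m}"
    using ev INT pE by (intro indep_eventsI) (auto simp: subset_iff)
  then show "prob (space M - (\<Union>j<m. E j)) = (1 - p) ^ m"
    using pE by (rule prob_none_of_indep_events)
qed

text \<open>The success probability \<open>p\<close> of a block is positive and the same for all
  \<open>m\<close>, so the failure probability \<open>(1 - p) ^ m\<close> tends to 0.\<close>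

lemma AE_block:
  fixes K :: nat and I :: "'n \<Rightarrow> nat \<Rightarrow> real set"
  assumes K: "0 < K" and I: "\<And>c i. I c i \<in> sets borel"
    and pos: "\<And>c i. 0 < measure (density lborel std_normal_density) (I c i)"
  shows "AE \<omega> in M. \<exists>m j. j < m \<and>
     (\<forall>c. \<forall>i<K. std_increment B (1 / real (m * K)) c (j * K + i) \<omega> \<in> I c i)"
proof -
  interpret N: prob_space "density lborel std_normal_density"
    by (rule prob_space_normal_density) simp
  define p where "p = (\<Prod>c\<in>UNIV. \<Prod>i<K. measure (density lborel std_normal_density) (I c i))"
  have p: "0 < p" "p \<le> 1"
    unfolding p_def using pos by (auto intro!: prod_pos prod_le_1 simp: prod_nonneg)
  define E where "E m j = {\<omega> \<in> space M. \<forall>c. \<forall>i<K.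
      std_increment B (1 / real (m * K)) c (j * K + i) \<omega> \<in> I c i}" for m j
  have pr: "prob (space M - (\<Union>j<m. E m j)) = (1 - p) ^ m"
    and ev: "\<And>j. j < m \<Longrightarrow> E m j \<in> events" if "0 < m" for m
    unfolding E_def p_def using K that by (intro prob_no_block I; simp)+
  \<comment> \<open>\<open>Z\<close> is failure for every \<open>m\<close> at once, so each single
    failure probability bounds it. The value \<open>m = 0\<close> is left out because its step size
    would be 0.\<close>
  define Z where "Z = (\<Inter>m\<in>{0<..}. space M - (\<Union>j<m. E m j))"
  have Z: "Z \<in> events" unfolding Z_def using ev by (intro sets.countable_INT') auto
  have "prob Z \<le> (1 - p) ^ Suc m" for m
    unfolding pr[OF zero_less_Suc, symmetric] Z_def
    by (intro finite_measure_mono) (use ev in auto)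
  moreover have "(\<lambda>m. (1 - p) ^ Suc m) \<longlonglongrightarrow> 0"
    using p by (intro LIMSEQ_Suc LIMSEQ_realpow_zero) auto
  ultimately have "prob Z \<le> 0"
    by (intro LIMSEQ_le_const) auto
  then have "Z \<in> null_sets M"
    using Z by (simp add: null_setsI emeasure_eq_measure measure_le_0_iff)
  then show ?thesis
    by (rule AE_I') (auto simp: Z_def E_def)
qed

lemma B_eq_sum_std_increment:
  assumes "0 < \<delta>"
  shows "B (real (k + i) * \<delta>) \<omega> $ c - B (real k * \<delta>) \<omega> $ c
    = sqrt \<delta> * (\<Sum>l<i. std_increment B \<delta> c (k + l) \<omega>)"
proof (induction i)
  case (Suc i)
  have "sqrt \<delta> * std_increment B \<delta> c (k + i) \<omega>
      = B (real (k + Suc i) * \<delta>) \<omega> $ c - B (real (k + i) * \<delta>) \<omega> $ c"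
    using assms by (simp add: std_increment_def)
  then show ?case using Suc by (simp add: distrib_left)
qed simp

section \<open>Paths passing near every point of a lattice cube\<close>

lemma AE_grid_count_ge:
  fixes N :: nat
  assumes N: "1 \<le> N"
  shows "AE \<omega> in M. \<exists>x\<in>(\<lambda>t. B t \<omega>) ` {0..1}. \<exists>h>0. N ^ CARD('n) \<le>
     grid_count (cball x (3 * real CARD('n) * real N * h) \<inter> (\<lambda>t. B t \<omega>) ` {0..1}) h"
proof -
  define K where "K = N ^ CARD('n)"
  have K: "0 < K" using N by (simp add: K_def)
  define T :: "('n \<Rightarrow> nat) set" where "T = PiE UNIV (\<lambda>_. {..<N})"
  have "card T = K" "finite T"
    unfolding T_def K_def by (simp_all add: card_PiE finite_PiE)
  then obtain b where b: "bij_betw b {0..<K} T"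
    using ex_bij_betw_nat_finite by blast
  \<comment> \<open>The targets in units of \<open>h\<close>: the block starts at the origin
    \<open>z 0\<close>, and \<open>z (Suc i)\<close> is twice the lattice point number
    \<open>i\<close>. The factor 2 leaves room for errors. Any enumeration \<open>b\<close> will do,
    since jumps of every size have positive probability.\<close>
  define z where "z i c = (case i of 0 \<Rightarrow> 0 | Suc i' \<Rightarrow> 2 * real (b i' c))" for i c
  have z_0: "z 0 c = 0" for c by (simp add: z_def)
  have z_le: "0 \<le> z i c \<and> z i c \<le> 2 * real N" if "i \<le> K" for i c
  proof (cases i)
    case (Suc i')
    then have "b i' \<in> T" using b that by (auto simp: bij_betw_def)
    then have "b i' c < N" by (auto simp: T_def PiE_iff)
    then show ?thesis by (simp add: z_def Suc)
  qed (simp add: z_def)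
  \<comment> \<open>With this tolerance the errors of all \<open>K\<close> steps add up to at most \<open>1 / 4\<close>.\<close>
  define \<eta> where "\<eta> = 1 / (4 * real K)"
  \<comment> \<open>Step \<open>i\<close> is meant to carry the path from \<open>z i\<close> to
    \<open>z (Suc i)\<close>.\<close>
  define I where "I c i = {z (Suc i) c - z i c - \<eta><..<z (Suc i) c - z i c + \<eta>}" for c i
  have \<eta>: "0 < \<eta>" using K by (simp add: \<eta>_def)
  have "AE \<omega> in M. \<exists>m j. j < m \<and>
     (\<forall>c. \<forall>i<K. std_increment B (1 / real (m * K)) c (j * K + i) \<omega> \<in> I c i)"
    using K \<eta> by (intro AE_block) (auto simp: I_def intro!: std_normal_interval_pos)
  then show ?thesis
  proof eventually_elim
    fix \<omega>
    assume "\<exists>m j. j < m \<and>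
     (\<forall>c. \<forall>i<K. std_increment B (1 / real (m * K)) c (j * K + i) \<omega> \<in> I c i)"
    then obtain m j where jm: "j < m" and
      inc: "\<And>c i. i < K \<Longrightarrow> std_increment B (1 / real (m * K)) c (j * K + i) \<omega> \<in> I c i"
      by blast
    define \<delta> where "\<delta> = 1 / real (m * K)"
    define h where "h = sqrt \<delta>"
    define P where "P i = B (real (j * K + i) * \<delta>) \<omega>" for i
    let ?F = "(\<lambda>t. B t \<omega>) ` {0..1}"
    have mK: "0 < m * K" using jm K by simp
    have \<delta>: "0 < \<delta>" using mK by (simp add: \<delta>_def)
    have h: "0 < h" using \<delta> by (simp add: h_def)
    have PF: "P i \<in> ?F" if "i \<le> K" for i
    proof -
      have "Suc j * K \<le> m * K" using jm by (intro mult_le_mono1) simp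
      then have "real (j * K + i) \<le> real (m * K)" using that by (intro of_nat_mono) simp
      then have "real (j * K + i) * \<delta> \<le> 1" using mK unfolding \<delta>_def by (simp add: divide_le_eq_1)
      then show ?thesis using \<delta> unfolding P_def by auto
    qed
    \<comment> \<open>The target differences telescope, so the deviation is \<open>h\<close> times
      the sum of the first \<open>i\<close> step errors \<open>d l\<close>, each at most
      \<open>\<eta>\<close>.\<close>
    have near: "\<bar>P i $ c - P 0 $ c - h * z i c\<bar> \<le> h / 4" if i: "i \<le> K" for i c
    proof -
      define d where "d l = std_increment B \<delta> c (j * K + l) \<omega> - (z (Suc l) c - z l c)" for l
      have "\<bar>d l\<bar> \<le> \<eta>" if "l < K" for l
        using inc[OF that, of c] unfolding d_def I_def \<delta>_def by auto
      then have "\<bar>\<Sum>l<i. d l\<bar> \<le> (\<Sum>l<i. \<eta>)"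
        using i by (intro order_trans[OF sum_abs] sum_mono) auto
      also have "\<dots> \<le> real K * \<eta>" using i \<eta> by simp
      also have "\<dots> = 1 / 4" using K by (simp add: \<eta>_def)
      finally have sum_d: "\<bar>\<Sum>l<i. d l\<bar> \<le> 1 / 4" .
      have "(\<Sum>l<i. d l) = (\<Sum>l<i. std_increment B \<delta> c (j * K + l) \<omega>) - z i c"
        using sum_lessThan_telescope[of "\<lambda>l. z l c" i] z_0 by (simp add: d_def sum_subtractf)
      then have "P i $ c - P 0 $ c - h * z i c = h * (\<Sum>l<i. d l)"
        using B_eq_sum_std_increment[OF \<delta>, of "j * K" i \<omega> c]
        unfolding P_def h_def by (simp add: right_diff_distrib)
      then show ?thesis using sum_d h by (simp add: abs_mult mult_left_mono[of _ "1/4" h, simplified])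
    qed
    \<comment> \<open>Each coordinate moves by at most \<open>2 * N * h + h / 4\<close>, hence by at
      most \<open>3 * N * h\<close>; bounding the norm by the sum over coordinates brings in the
      factor \<open>CARD('n)\<close>.\<close>
    have dist_P: "P i \<in> cball (P 0) (3 * real CARD('n) * real N * h)" if i: "i \<le> K" for i
    proof -
      have "\<bar>P i $ c - P 0 $ c\<bar> \<le> 3 * real N * h" for c
      proof -
        have "\<bar>P i $ c - P 0 $ c\<bar> \<le> h * z i c + h / 4"
          using near[OF i, of c] z_le[OF i, of c] h by (smt (verit) mult_nonneg_nonneg)
        also have "\<dots> \<le> h * (2 * real N) + h * real N"
          using h N z_le[OF i, of c] by (intro add_mono mult_left_mono) auto
        finally show ?thesis by (simp add: algebra_simps)
      qed
      then have "(\<Sum>c\<in>UNIV. \<bar>(P i - P 0) $ c\<bar>) \<le> (\<Sum>c\<in>(UNIV :: 'n set). 3 * real N * h)"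
        by (intro sum_mono) simp
      then have "norm (P i - P 0) \<le> 3 * real CARD('n) * real N * h"
        using norm_le_l1_cart[of "P i - P 0"] by (simp add: algebra_simps)
      then show ?thesis by (simp add: dist_norm norm_minus_commute)
    qed
    have "card {0..<K} \<le> grid_count (cball (P 0) (3 * real CARD('n) * real N * h) \<inter> ?F) h"
    \<comment> \<open>The points start at \<open>P 1\<close>: \<open>P 0\<close> serves as the
      centre, and its target, the origin, occurs again among the later ones.\<close>
    proof (rule card_le_grid_count[OF h Int_lower1, where p = "\<lambda>i. P (Suc i)"])
      show "(\<lambda>i. P (Suc i)) ` {0..<K} \<subseteq> cball (P 0) (3 * real CARD('n) * real N * h) \<inter> ?F"
        using PF dist_P by (intro image_subsetI IntI) auto
      fix i i' assume ii: "i \<in> {0..<K}" "i' \<in> {0..<K}" "i \<noteq> i'"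
      then have "b i \<noteq> b i'" using b by (auto simp: bij_betw_def inj_on_def)
      then obtain c where "b i c \<noteq> b i' c" by auto
      then have "2 \<le> \<bar>z (Suc i) c - z (Suc i') c\<bar>" by (simp add: z_def)
      then have "h * 2 \<le> \<bar>h * z (Suc i) c - h * z (Suc i') c\<bar>"
        using h by (simp add: abs_mult flip: right_diff_distrib)
      moreover have "\<bar>P (Suc i) $ c - P 0 $ c - h * z (Suc i) c\<bar> \<le> h / 4"
        "\<bar>P (Suc i') $ c - P 0 $ c - h * z (Suc i') c\<bar> \<le> h / 4"
        using ii by (intro near; simp)+
      \<comment> \<open>A gap of \<open>2 * h\<close> between targets, less two errors of
        \<open>h / 4\<close>, still exceeds \<open>h\<close>.\<close>
      ultimately have "h < \<bar>P (Suc i) $ c - P (Suc i') $ c\<bar>" using h by linarith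
      then show "\<exists>c. h < \<bar>P (Suc i) $ c - P (Suc i') $ c\<bar>" by blast
    qed
    then show "\<exists>x\<in>?F. \<exists>h>0. N ^ CARD('n) \<le>
        grid_count (cball x (3 * real CARD('n) * real N * h) \<inter> ?F) h"
      using h PF[of 0] unfolding K_def card_atLeastLessThan diff_zero by blast
  qed
qed

end

theorem theorem4p2:
  fixes M :: "'a measure" and B :: "real \<Rightarrow> 'a \<Rightarrow> real ^ 'n"
  assumes "brownian_motion M B"
  shows "AE \<omega> in M. assouad_dim ((\<lambda>t. B t \<omega>) ` {0..1}) = real CARD('n)"
proof -
  interpret brownian_motion M B by (rule assms)
  \<comment> \<open>Only countably many \<open>N\<close> occur, so a single null set serves them
    all.\<close>
  have "AE \<omega> in M. \<forall>N::nat. 1 \<le> N \<longrightarrow> (\<exists>x\<in>(\<lambda>t. B t \<omega>) ` {0..1}. \<exists>h>0. N ^ CARD('n) \<le>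
     grid_count (cball x (3 * real CARD('n) * real N * h) \<inter> (\<lambda>t. B t \<omega>) ` {0..1}) h)"
    using AE_grid_count_ge by (auto simp: AE_all_countable)
  then show ?thesis
  proof eventually_elim
    fix \<omega>
    let ?F = "(\<lambda>t. B t \<omega>) ` {0..1}"
    assume rich: "\<forall>N::nat. 1 \<le> N \<longrightarrow> (\<exists>x\<in>?F. \<exists>h>0. N ^ CARD('n) \<le>
       grid_count (cball x (3 * real CARD('n) * real N * h) \<inter> ?F) h)"
    have "1 \<le> 3 * real CARD('n)"
      using zero_less_card_finite[where 'a='n] by linarith
    then have "real CARD('n) \<le> s" if "homogeneous s ?F" for s
      using that rich by (intro CARD_le_homogeneous_exponent) blast+
    then show "assouad_dim ?F = real CARD('n)"
      \<comment> \<open>The infimum is attained: the dimension is itself an admissible exponent and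
        a lower bound for all others.\<close>
      unfolding assouad_dim_def using homogeneous_CARD[of ?F]
      by (intro cInf_eq_minimum) auto
  qed
qed

end
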